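(* Let $q$ be a prime power. The number of elementary totally positive $2\times 2$ matrices over $\mathbb{F}_q$ is $$\begin{cases} q-2 & \text{if } q \text{ is even},\\[0.4em] \dfrac{q-5}{4} & \text{if } q\equiv 1\pmod 4,\\[0.6em] \dfrac{q-3}{4} & \text{if } q\equiv 3\pmod 4.\end{cases}$$ If $\mathbb{F}_q$ has characteristic $2$, then the number of elementary totally positive $3\times 3$ matrices over $\mathbb{F}_q$ is $$(q-2)(q-3)(q^2-9q+21).$$
   Context: An element $a\in\mathbb{F}_q^\times$ is positive if $a=b^2$ for some $b\in\mathbb{F}_q^\times$. A matrix over $\mathbb{F}_q$ is totally positive if all of its minors (of all sizes) are positive. An elementary totally positive matrix is a totally positive matrix whose entries in the first row and the first column are all equal to $1$. *)

theory Defs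
  imports
    "HOL-Number_Theory.Prime_Powers"
    "Jordan_Normal_Form.Determinant"
    "Jordan_Normal_Form.DL_Submatrix"
begin

definition positive_elem :: "'a :: field \<Rightarrow> bool" where
  "positive_elem a \<longleftrightarrow> (\<exists>b. b \<noteq> 0 \<and> a = b\<^sup>2)"

text \<open>
  A minor of a matrix is the determinant of the square submatrix formed by a nonempty set \<open>I\<close>
  of rows and an equinumerous set \<open>J\<close> of columns. Rows and columns are numbered from 0.
\<close>

definition totally_positive :: "'a :: field mat \<Rightarrow> bool" where
  "totally_positive A \<longleftrightarrow>
     (\<forall>I J. I \<subseteq> {..<dim_row A} \<longrightarrow> J \<subseteq> {..<dim_col A} \<longrightarrow> I \<noteq> {} \<longrightarrow> card I = card J \<longrightarrow>
        positive_elem (det (submatrix A I J)))"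

definition elementary_totally_positive :: "'a :: field mat \<Rightarrow> bool" where
  "elementary_totally_positive A \<longleftrightarrow>
     totally_positive A \<and>
     (\<forall>j < dim_col A. A $$ (0, j) = 1) \<and>
     (\<forall>i < dim_row A. A $$ (i, 0) = 1)"

definition elementary_tp_mats :: "nat \<Rightarrow> 'a :: field mat set" where
  "elementary_tp_mats n = {A \<in> carrier_mat n n. elementary_totally_positive A}"

end

theory Submission
  imports Defs "HOL-Number_Theory.Residues"
begin

text \<open>
  For odd \<open>q\<close>, the hyperbola \<open>x\<^sup>2 - y\<^sup>2 = 1\<close> has \<open>q - 1\<close> points. Every \<open>a\<close> for which \<open>a\<close> and \<open>a - 1\<close>
  are positive contributes four of them, the points with \<open>y = 0\<close> number two, and those with \<open>x = 0\<close>
  number zero or two; the residue of \<open>q\<close> modulo 4 then decides between the last two cases, so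
  that the quadratic character of \<open>- 1\<close> need not be known beforehand.

  In characteristic 2, positive means nonzero. With the entries \<open>a, b, c\<close> of the lower right
  \<open>2 \<times> 2\<close> block chosen, the minors forbid six values of the last entry \<open>d\<close>, and as \<open>c\<close> varies
  these six values coincide in pairs exactly three times, which gives
  \<open>(q - 3) * (q - 6) + 3 = q\<^sup>2 - 9 * q + 21\<close> choices of \<open>(c, d)\<close> for every \<open>(a, b)\<close>.
\<close>

section \<open>Determinants and minors of small matrices\<close>

lemma det_2x2:
  assumes "A \<in> carrier_mat 2 2"
  shows "det A = A $$ (0,0) * A $$ (1,1) - A $$ (0,1) * A $$ (1,0)"
  using assms
  by (subst laplace_expansion_column[OF assms, of 0])
     (auto simp: cofactor_def det_single mat_delete_def numeral_2_eq_2 mult.commute)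

lemma det_3x3:
  assumes "A \<in> carrier_mat 3 3"
  shows "det A = A $$ (0,0) * (A $$ (1,1) * A $$ (2,2) - A $$ (1,2) * A $$ (2,1))
               - A $$ (1,0) * (A $$ (0,1) * A $$ (2,2) - A $$ (0,2) * A $$ (2,1))
               + A $$ (2,0) * (A $$ (0,1) * A $$ (1,2) - A $$ (0,2) * A $$ (1,1))"
proof -
  have minor: "det (mat_delete A i 0) = mat_delete A i 0 $$ (0,0) * mat_delete A i 0 $$ (1,1)
          - mat_delete A i 0 $$ (0,1) * mat_delete A i 0 $$ (1,0)" for i
    using assms by (intro det_2x2) (auto simp: mat_delete_def)
  have "det A = A $$ (0,0) * det (mat_delete A 0 0) - A $$ (1,0) * det (mat_delete A 1 0)
               + A $$ (2,0) * det (mat_delete A 2 0)"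
    by (subst laplace_expansion_column[OF assms, of 0])
       (auto simp: cofactor_def eval_nat_numeral)
  also have "\<dots> = A $$ (0,0) * (A $$ (1,1) * A $$ (2,2) - A $$ (1,2) * A $$ (2,1))
               - A $$ (1,0) * (A $$ (0,1) * A $$ (2,2) - A $$ (0,2) * A $$ (2,1))
               + A $$ (2,0) * (A $$ (0,1) * A $$ (1,2) - A $$ (0,2) * A $$ (1,1))"
    unfolding minor using assms by (simp add: mat_delete_def eval_nat_numeral)
  finally show ?thesis .
qed

lemma pick_lessThan:
  assumes "i < n"
  shows "pick {..<n} i = i"
proof -
  have "{a \<in> {..<n}. a < i} = {..<i}"
    using assms by auto
  then show ?thesis
    using pick_card_in_set[of i "{..<n}"] assms by simp
qed

lemma submatrix_lessThan: "submatrix A {..<dim_row A} {..<dim_col A} = A"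
  by (rule eq_matI) (auto simp: dim_submatrix submatrix_index pick_lessThan)

lemma det_submatrix_singletons:
  assumes "i < dim_row A" "j < dim_col A"
  shows "det (submatrix A {i} {j}) = A $$ (i, j)"
proof -
  \<comment> \<open>\<open>submatrix\<close> takes its dimensions from the cardinalities of these
    two sets.\<close>
  have "{x. x < dim_row A \<and> x \<in> {i}} = {i}" "{x. x < dim_col A \<and> x \<in> {j}} = {j}"
    using assms by auto
  then have "submatrix A {i} {j} = mat 1 1 (\<lambda>(k, l). A $$ (pick {i} k, pick {j} l))"
    by (simp add: submatrix_def)
  then show ?thesis
    by (subst det_single) (auto intro!: arg_cong[of _ _ "($$) A"] Least_equality)
qed

lemma pick_pair:
  assumes "i < i'"
  shows "pick {i, i'} 0 = i" "pick {i, i'} (Suc 0) = i'"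
proof -
  show *: "pick {i, i'} 0 = i"
    using assms by (auto intro!: Least_equality)
  show "pick {i, i'} (Suc 0) = i'"
    unfolding pick.simps(2) * using assms by (auto intro!: Least_equality)
qed

lemma det_submatrix_pairs:
  assumes "i < i'" "i' < dim_row A" "j < j'" "j' < dim_col A"
  shows "det (submatrix A {i, i'} {j, j'}) = A $$ (i, j) * A $$ (i', j') - A $$ (i, j') * A $$ (i', j)"
proof -
  have "{x. x < dim_row A \<and> x \<in> {i, i'}} = {i, i'}" "{x. x < dim_col A \<and> x \<in> {j, j'}} = {j, j'}"
    using assms by auto
  moreover have "card {i, i'} = 2" "card {j, j'} = 2"
    using assms by auto
  ultimately have "submatrix A {i, i'} {j, j'} = mat 2 2 (\<lambda>(k, l). A $$ (pick {i, i'} k, pick {j, j'} l))"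
    by (simp only: submatrix_def)
  then show ?thesis
    using assms by (subst det_2x2) (auto simp: pick_pair simp del: pick.simps)
qed

section \<open>Total positivity in sizes 2 and 3\<close>

lemma totally_positive_Pow:
  "totally_positive A \<longleftrightarrow>
     (\<forall>I\<in>Pow {..<dim_row A}. \<forall>J\<in>Pow {..<dim_col A}. I \<noteq> {} \<longrightarrow> card I = card J \<longrightarrow>
        positive_elem (det (submatrix A I J)))"
  by (auto simp: totally_positive_def)

lemma totally_positive_2x2:
  assumes "A \<in> carrier_mat 2 2"
  shows "totally_positive A \<longleftrightarrow>
    (\<forall>i<2. \<forall>j<2. positive_elem (A $$ (i, j))) \<and>
    positive_elem (A $$ (0,0) * A $$ (1,1) - A $$ (0,1) * A $$ (1,0))"
proof -
  have dims [simp]: "dim_row A = 2" "dim_col A = 2" using assms by auto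
  have "{..<2} = {0, 1::nat}" by auto
  then show ?thesis
    unfolding totally_positive_Pow dims
    by (auto simp: Pow_insert det_submatrix_singletons det_submatrix_pairs less_2_cases_iff)
qed

lemma all_less_3: "(\<forall>i<3. P i) \<longleftrightarrow> P 0 \<and> P 1 \<and> P (2::nat)"
  by (auto simp: less_Suc_eq eval_nat_numeral)

lemma all_less_2: "(\<forall>i<2. P i) \<longleftrightarrow> P 0 \<and> P (1::nat)"
  by (auto simp: less_Suc_eq eval_nat_numeral)


text \<open>Groups the minors by size. The larger index of each pair is bound first, so that once it
  is a numeral the range of the smaller one can be unrolled too.\<close>

lemma totally_positive_3x3:
  assumes "A \<in> carrier_mat 3 3"
  shows "totally_positive A \<longleftrightarrow>
    (\<forall>i<3. \<forall>j<3. positive_elem (A $$ (i, j))) \<and>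
    (\<forall>i'<3. \<forall>i<i'. \<forall>j'<3. \<forall>j<j'.
       positive_elem (A $$ (i, j) * A $$ (i', j') - A $$ (i, j') * A $$ (i', j))) \<and>
    positive_elem (det A)"
proof -
  have dims: "dim_row A = 3" "dim_col A = 3"
    using assms by auto
  have 3: "{..<3} = {0, 1, 2::nat}"
    by (simp add: eval_nat_numeral lessThan_Suc insert_commute)
  have full: "submatrix A {0, Suc 0, 2} {0, Suc 0, 2} = A"
    using submatrix_lessThan[of A] by (simp add: 3 dims)
  have Pow: "(\<forall>I\<in>Pow {0, 1, 2::nat}. P I) \<longleftrightarrow>
      P {} \<and> P {0} \<and> P {1} \<and> P {2} \<and> P {0,1} \<and> P {0,2} \<and> P {1,2} \<and> P {0,1,2}" for P
    by (simp add: Pow_insert ball_Un image_Un conj_ac)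
  show ?thesis
    unfolding totally_positive_Pow dims 3 Pow
    by (simp add: full det_submatrix_singletons det_submatrix_pairs all_less_3 all_less_2 dims)
qed

section \<open>Characteristic and squares\<close>

lemma CHAR_eq_if_card_prime_power:
  assumes "prime p" "card (UNIV :: 'a :: finite_field set) = p ^ k"
  shows "CHAR('a) = p"
proof -
  have "CHAR('a) dvd p ^ k"
    using CHAR_dvd_CARD[where 'a = 'a] assms(2) by simp
  then show ?thesis
    using assms(1) by (meson CHAR_prime prime_dvd_power primes_dvd_imp_eq)
qed

text \<open>The characteristic is the prime of which the cardinality is a power, and a positive
  power of a prime is even exactly when the prime is 2.\<close>

lemma CHAR_eq_2_iff_even_card:
  assumes "primepow (card (UNIV :: 'a :: finite_field set))"
  shows "CHAR('a) = 2 \<longleftrightarrow> even (card (UNIV :: 'a set))"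
proof -
  obtain p k where pk: "prime p" "k > 0" "card (UNIV :: 'a set) = p ^ k"
    using assms by (auto simp: primepow_def)
  then show ?thesis
    using CHAR_eq_if_card_prime_power[OF pk(1,3)] primes_dvd_imp_eq[of 2 p] by auto
qed

lemma two_eq_0_iff_CHAR: "(2 :: 'a :: idom) = 0 \<longleftrightarrow> CHAR('a) = 2"
proof -
  have "(2 :: 'a) = 0 \<longleftrightarrow> CHAR('a) dvd 2"
    using of_nat_eq_0_iff_char_dvd[of 2, where 'a = 'a] by simp
  also have "\<dots> \<longleftrightarrow> CHAR('a) = 2"
    using CHAR_not_1'[where 'a = 'a] prime_nat_iff[of 2] by auto
  finally show ?thesis .
qed

text \<open>In characteristic 2 the roots \<open>y\<close> and \<open>- y\<close> coincide, so
  squaring is injective, hence surjective on a finite field.\<close>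

lemma positive_elem_CHAR_2:
  fixes x :: "'a :: finite_field"
  assumes "CHAR('a) = 2"
  shows "positive_elem x \<longleftrightarrow> x \<noteq> 0"
proof
  assume "x \<noteq> 0"
  have "inj (\<lambda>y :: 'a. y\<^sup>2)"
    using uminus_CHAR_2[OF assms] by (auto simp: inj_def power2_eq_iff)
  then have "surj (\<lambda>y :: 'a. y\<^sup>2)"
    by (simp add: finite_UNIV_inj_surj)
  then obtain y where "x = y\<^sup>2"
    by (metis surjD)
  with \<open>x \<noteq> 0\<close> show "positive_elem x"
    by (auto simp: positive_elem_def)
qed (auto simp: positive_elem_def)

lemma positive_elem_square: "positive_elem (x\<^sup>2) \<longleftrightarrow> x \<noteq> 0"
  by (auto simp: positive_elem_def)

section \<open>Elementary matrices parametrised by their free entries\<close>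

lemma card_elementary_tp_mats_2:
  "card (elementary_tp_mats 2 :: 'a :: field mat set) =
     card {a :: 'a. positive_elem a \<and> positive_elem (a - 1)}"
proof (rule bij_betw_same_card)
  let ?M = "\<lambda>a :: 'a. mat 2 2 (\<lambda>(i, j). if i = 0 \<or> j = 0 then 1 else a)"
  \<comment> \<open>The border entries are squares, so only the free entry \<open>a\<close> and the
    determinant \<open>a - 1\<close> impose conditions.\<close>
  have one: "positive_elem (1 :: 'a)"
    by (auto simp: positive_elem_def intro!: exI[of _ 1])
  have M: "?M (A $$ (1, 1)) = A" if "A \<in> elementary_tp_mats 2" for A
    using that
    by (intro eq_matI) (auto simp: elementary_tp_mats_def elementary_totally_positive_def less_2_cases_iff)
  show "bij_betw (\<lambda>A :: 'a mat. A $$ (1, 1)) (elementary_tp_mats 2)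
          {a. positive_elem a \<and> positive_elem (a - 1)}"
  proof (rule bij_betw_byWitness[where f' = ?M])
    show "?M ` {a. positive_elem a \<and> positive_elem (a - 1)} \<subseteq> elementary_tp_mats 2"
      by (auto simp: elementary_tp_mats_def elementary_totally_positive_def totally_positive_2x2
           all_less_2 one)
    show "(\<lambda>A. A $$ (1, 1)) ` elementary_tp_mats 2 \<subseteq> {a :: 'a. positive_elem a \<and> positive_elem (a - 1)}"
      by (auto simp: elementary_tp_mats_def elementary_totally_positive_def totally_positive_2x2
           all_less_2)
  qed (auto simp: M)
qed

text \<open>Each minor must be nonzero, which rules out one value of the last chosen entry in it.
  For \<open>d\<close>, the two fractions come from the minor \<open>a * d - b * c\<close> and from
  the full determinant. The nested form lets the entries be counted one at a time.\<close>

lemma card_elementary_tp_mats_3: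
  assumes pos: "\<And>x :: 'a :: field. positive_elem x \<longleftrightarrow> x \<noteq> 0"
  shows "card (elementary_tp_mats 3 :: 'a mat set) =
     card (SIGMA a : - {0, 1 :: 'a}. SIGMA b : - {0, 1, a}. SIGMA c : - {0, 1, a}.
             - {0, 1, b, c, b * c / a, 1 + (b - 1) * (c - 1) / (a - 1)})"
  (is "_ = card ?Q")
proof (rule bij_betw_same_card)
  let ?M = "\<lambda>(a :: 'a, b :: 'a, c :: 'a, d :: 'a). mat 3 3 (\<lambda>(i, j).
     if i = 0 \<or> j = 0 then 1 else if i = 1 then if j = 1 then a else b else if j = 1 then c else d)"
  let ?f = "\<lambda>A :: 'a mat. (A $$ (1, 1), A $$ (1, 2), A $$ (2, 1), A $$ (2, 2))"
  have quot: "d = b * c / a \<longleftrightarrow> a * d - b * c = 0" if "a \<noteq> 0" for a b c d :: 'a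
    using that by (simp add: field_simps)
  have quot': "d = 1 + (b - 1) * (c - 1) / (a - 1) \<longleftrightarrow> (a - 1) * (d - 1) - (b - 1) * (c - 1) = 0"
    if "a \<noteq> 1" for a b c d :: 'a
    using that by (simp add: field_simps)
  \<comment> \<open>Every exclusion becomes a nonvanishing difference, the shape in which the minors
    appear.\<close>
  have Q: "(a, b, c, d) \<in> ?Q \<longleftrightarrow> a \<noteq> 0 \<and> b \<noteq> 0 \<and> c \<noteq> 0 \<and> d \<noteq> 0 \<and>
      a - 1 \<noteq> 0 \<and> b - 1 \<noteq> 0 \<and> c - 1 \<noteq> 0 \<and> d - 1 \<noteq> 0 \<and>
      b - a \<noteq> 0 \<and> c - a \<noteq> 0 \<and> d - b \<noteq> 0 \<and> d - c \<noteq> 0 \<and>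
      a * d - b * c \<noteq> 0 \<and> (a - 1) * (d - 1) - (b - 1) * (c - 1) \<noteq> 0" for a b c d :: 'a
    using quot[of a d b c] quot'[of a d b c] by auto
  have el: "A \<in> elementary_tp_mats 3 \<longleftrightarrow> A \<in> carrier_mat 3 3 \<and> A $$ (0, 0) = 1 \<and>
     A $$ (0, 1) = 1 \<and> A $$ (0, 2) = 1 \<and> A $$ (1, 0) = 1 \<and> A $$ (2, 0) = 1 \<and> ?f A \<in> ?Q"
    for A :: "'a mat"
  proof (cases "A \<in> carrier_mat 3 3 \<and> A $$ (0, 0) = 1 \<and>
     A $$ (0, 1) = 1 \<and> A $$ (0, 2) = 1 \<and> A $$ (1, 0) = 1 \<and> A $$ (2, 0) = 1")
    case True
    define a b c d where "a = A $$ (1, 1)" and "b = A $$ (1, 2)" and "c = A $$ (2, 1)" and "d = A $$ (2, 2)"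
    have dims: "dim_row A = 3" "dim_col A = 3"
      using True by auto
    \<comment> \<open>Clearing the border of ones by row operations leaves the lower right block
      with all entries lowered by 1.\<close>
    have det: "det A = (a - 1) * (d - 1) - (b - 1) * (c - 1)"
      using True by (simp add: det_3x3 a_def b_def c_def d_def algebra_simps)
    show ?thesis
      using True unfolding Q
      by (simp add: elementary_tp_mats_def elementary_totally_positive_def dims totally_positive_3x3
            all_less_2 all_less_3 pos det a_def b_def c_def d_def) (auto simp: algebra_simps)
  next
    case False
    then show ?thesis
      by (auto simp: elementary_tp_mats_def elementary_totally_positive_def all_less_3)
  qed
  have M: "?M (?f A) = A" if "A \<in> elementary_tp_mats 3" for A
    using that unfolding el by (intro eq_matI) (auto simp: eval_nat_numeral less_Suc_eq)
  have f: "?f (?M x) = x" for x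
    by (auto split: prod.splits)
  show "bij_betw ?f (elementary_tp_mats 3) ?Q"
  proof (rule bij_betw_byWitness[where f' = ?M])
    show "?f ` elementary_tp_mats 3 \<subseteq> ?Q"
      by (auto simp only: el)
    show "?M ` ?Q \<subseteq> elementary_tp_mats 3"
    proof
      fix A assume "A \<in> ?M ` ?Q"
      then obtain x where "x \<in> ?Q" "A = ?M x"
        by (rule imageE)
      moreover obtain a b c d where "x = (a, b, c, d)"
        by (cases x)
      ultimately have x: "(a, b, c, d) \<in> ?Q" "A = ?M (a, b, c, d)"
        by simp_all
      have "?f A = (a, b, c, d)"
        using x(2) by simp
      then have "?f A \<in> ?Q"
        using x(1) by (simp only:)
      moreover have "A \<in> carrier_mat 3 3 \<and> A $$ (0, 0) = 1 \<and>
          A $$ (0, 1) = 1 \<and> A $$ (0, 2) = 1 \<and> A $$ (1, 0) = 1 \<and> A $$ (2, 0) = 1"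
        using x(2) by simp
      ultimately show "A \<in> elementary_tp_mats 3"
        unfolding el by blast
    qed
    show "\<forall>A \<in> elementary_tp_mats 3. ?M (?f A) = A"
      by (intro ballI M)
    show "\<forall>x \<in> ?Q. ?f (?M x) = x"
      by (intro ballI f)
  qed
qed

section \<open>Counting the free entries for size 3\<close>

lemma int_card_Compl:
  fixes S :: "'a :: finite set"
  shows "int (card (- S)) = int (card (UNIV :: 'a set)) - int (card S)"
  using card_Un_disjoint[of S "- S"] by simp

text \<open>The six forbidden values form three pairs: \<open>b\<close> and \<open>c\<close>,
  \<open>1\<close> and \<open>b * c / a\<close>, and \<open>0\<close> and the last fraction. Values
  coincide only within a pair, and each coincidence frees one element.\<close>

lemma card_Compl_forbidden:
  fixes a b c :: "'a :: {finite, field}"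
  assumes "a \<notin> {0, 1}" "b \<notin> {0, 1, a}" "c \<notin> {0, 1, a}"
  shows "int (card (- {0, 1, b, c, b * c / a, 1 + (b - 1) * (c - 1) / (a - 1)})) =
     int (card (UNIV :: 'a set)) - 6 + of_bool (c = b) + of_bool (c = a / b) + of_bool (c = (b - a) / (b - 1))"
proof -
  define e f where "e = b * c / a" and "f = 1 + (b - 1) * (c - 1) / (a - 1)"
  have e: "e \<noteq> 0" "e \<noteq> b" "e \<noteq> c" "e = 1 \<longleftrightarrow> c = a / b"
    using assms by (auto simp: e_def field_simps)
  have f: "f \<noteq> 1"
    using assms by (auto simp: f_def)
  \<comment> \<open>In product form, \<open>f = b\<close> forces \<open>c = a\<close>, and
    \<open>f = c\<close> forces \<open>b = a\<close>; both are excluded.\<close>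
  have f_eq: "f = x \<longleftrightarrow> (b - 1) * (c - 1) = (a - 1) * (x - 1)" for x
    using assms by (auto simp: f_def field_simps)
  have f': "f \<noteq> b" "f \<noteq> c"
    using assms by (auto simp: f_eq)
  have f0: "f = 0 \<longleftrightarrow> c = (b - a) / (b - 1)"
    unfolding f_eq using assms by (auto simp: field_simps)
  have "f \<noteq> e"
  proof
    assume "f = e"
    then have "(b - 1) * (c - 1) = (a - 1) * (e - 1)"
      by (simp add: f_eq)
    \<comment> \<open>Multiplying by \<open>a\<close> allows \<open>a * e\<close> to be replaced by
      \<open>b * c\<close>, after which the equation factors.\<close>
    then have "a * ((b - 1) * (c - 1)) = (a - 1) * (a * e - a)"
      by (simp only:) (simp add: algebra_simps)
    also have "a * e = b * c"
      using assms by (simp add: e_def)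
    finally have "(a - b) * (c - a) = 0"
      by (simp add: algebra_simps)
    then show False
      using assms by simp
  qed
  then have "int (card {0, 1, b, c, e, f}) =
      6 - of_bool (c = b) - of_bool (c = a / b) - of_bool (c = (b - a) / (b - 1))"
    unfolding e(4)[symmetric] f0[symmetric]
    using assms e(1-3) f f' by (auto simp: card_insert_if)
  then show ?thesis
    by (simp add: int_card_Compl e_def f_def)
qed

text \<open>The sum over \<open>c\<close> does not depend on \<open>a\<close> and \<open>b\<close>,
  so the total is a product of three factors.\<close>

lemma card_Sigma_Compl_forbidden:
  defines "q \<equiv> int (card (UNIV :: 'a :: {finite, field} set))"
  shows "int (card (SIGMA a : - {0, 1 :: 'a}. SIGMA b : - {0, 1, a}. SIGMA c : - {0, 1, a}.
             - {0, 1, b, c, b * c / a, 1 + (b - 1) * (c - 1) / (a - 1)})) =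
     (q - 2) * (q - 3) * (q\<^sup>2 - 9 * q + 21)"
proof -
  note Compl = int_card_Compl[where 'a = 'a, folded q_def]
  have inner: "(\<Sum>c \<in> - {0, 1, a}. int (card (- {0, 1, b, c, b * c / a, 1 + (b - 1) * (c - 1) / (a - 1)}))) =
      q\<^sup>2 - 9 * q + 21" if ab: "a \<in> - {0, 1}" "b \<in> - {0, 1, a}" for a b :: 'a
  proof -
    \<comment> \<open>Each indicator is thus hit exactly once as \<open>c\<close> varies, giving the
      summand 3. The three values may be equal to one another, since the indicators are summed
      separately.\<close>
    have roots: "b \<in> - {0, 1, a}" "a / b \<in> - {0, 1, a}" "(b - a) / (b - 1) \<in> - {0, 1, a}"
      using ab by (auto simp: field_simps)
    have "(\<Sum>c \<in> - {0, 1, a}. int (card (- {0, 1, b, c, b * c / a, 1 + (b - 1) * (c - 1) / (a - 1)}))) =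
        (\<Sum>c \<in> - {0, 1, a}. q - 6 + of_bool (c = b) + of_bool (c = a / b) + of_bool (c = (b - a) / (b - 1)))"
      using ab by (intro sum.cong refl) (subst card_Compl_forbidden, auto simp: q_def)
    also have "\<dots> = (q - 3) * (q - 6) + 3"
    proof -
      have "int (card (- {0, 1, a})) = q - 3"
        using ab by (simp add: Compl)
      then show ?thesis
        using roots by (simp add: sum.distrib of_bool_def del: Compl_iff Compl_insert)
    qed
    finally show ?thesis
      by (simp add: power2_eq_square algebra_simps)
  qed
  have "int (card (SIGMA a : - {0, 1 :: 'a}. SIGMA b : - {0, 1, a}. SIGMA c : - {0, 1, a}.
             - {0, 1, b, c, b * c / a, 1 + (b - 1) * (c - 1) / (a - 1)})) =
        (\<Sum>a \<in> - {0, 1 :: 'a}. \<Sum>b \<in> - {0, 1, a}. q\<^sup>2 - 9 * q + 21)"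
    by (simp add: inner del: Compl_iff Compl_insert sum_constant)
  also have "\<dots> = (\<Sum>a \<in> - {0, 1 :: 'a}. (q - 3) * (q\<^sup>2 - 9 * q + 21))"
    using Compl by (intro sum.cong refl) (simp add: card_insert_if)
  also have "\<dots> = (q - 2) * (q - 3) * (q\<^sup>2 - 9 * q + 21)"
    using Compl[of "{0, 1}"] by simp
  finally show ?thesis .
qed

section \<open>Consecutive squares and the hyperbola in odd characteristic\<close>

lemma square_roots:
  fixes b :: "'a :: field"
  shows "{x. x\<^sup>2 = b\<^sup>2} = {b, - b}"
  by (auto simp: power2_eq_iff)

lemma card_square_roots:
  fixes a :: "'a :: field"
  assumes "(2 :: 'a) \<noteq> 0" "positive_elem a"
  shows "card {x. x\<^sup>2 = a} = 2"
proof -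
  obtain b where b: "b \<noteq> 0" "a = b\<^sup>2"
    using assms by (auto simp: positive_elem_def)
  have "b \<noteq> - b"
  proof
    assume "b = - b"
    then have "2 * b = 0"
      by (metis add.right_inverse mult_2)
    with assms b show False by simp
  qed
  with b show ?thesis
    by (simp add: square_roots)
qed

text \<open>Since \<open>(x + y) * (x - y) = 1\<close>, a point is determined by the unit
  \<open>u = x + y\<close>, with \<open>x - y\<close> its inverse.\<close>

lemma card_hyperbola:
  assumes "(2 :: 'a :: {finite, field}) \<noteq> 0"
  shows "card {(x, y :: 'a). x\<^sup>2 - y\<^sup>2 = 1} = card (UNIV :: 'a set) - 1"
proof -
  have "bij_betw (\<lambda>(x, y). x + y) {(x, y :: 'a). x\<^sup>2 - y\<^sup>2 = 1} (- {0})"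
  \<comment> \<open>The witness solves \<open>x + y = u\<close> and \<open>x - y = 1 / u\<close>,
    which requires dividing by 2.\<close>
  proof (rule bij_betw_byWitness[where f' = "\<lambda>u. ((u + 1 / u) / 2, (u - 1 / u) / 2)"])
    have inv: "1 / (x + y) = x - y" "x + y \<noteq> 0" if "x\<^sup>2 - y\<^sup>2 = 1" for x y :: 'a
    proof -
      have *: "(x + y) * (x - y) = 1"
        using that by (simp add: power2_eq_square algebra_simps)
      then show "x + y \<noteq> 0" by auto
      with * show "1 / (x + y) = x - y"
        by (simp add: field_simps)
    qed
    show "\<forall>p\<in>{(x, y :: 'a). x\<^sup>2 - y\<^sup>2 = 1}.
       (((case p of (x, y) \<Rightarrow> x + y) + 1 / (case p of (x, y) \<Rightarrow> x + y)) / 2,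
        ((case p of (x, y) \<Rightarrow> x + y) - 1 / (case p of (x, y) \<Rightarrow> x + y)) / 2) = p"
      using assms by (auto simp: inv)
    show "\<forall>u\<in>- {0}. (case ((u + 1 / u) / 2, (u - 1 / u) / 2) of (x, y) \<Rightarrow> x + y) = (u :: 'a)"
      using assms by (auto simp: add_divide_distrib [symmetric])
    show "(\<lambda>(x, y). x + y) ` {(x, y :: 'a). x\<^sup>2 - y\<^sup>2 = 1} \<subseteq> - {0}"
      using inv by auto
    \<comment> \<open>Needed at \<open>v = 1 / u\<close>, where the product is 1.\<close>
    have "((u + v) / 2)\<^sup>2 - ((u - v) / 2)\<^sup>2 = u * v" for u v :: 'a
    proof -
      have "(u + v) / 2 + (u - v) / 2 = u" "(u + v) / 2 - (u - v) / 2 = v"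
        using assms by (simp_all add: add_divide_distrib [symmetric] diff_divide_distrib [symmetric])
      then show ?thesis
        by (simp only: power2_eq_square square_diff_square_factored)
    qed
    then show "(\<lambda>u. ((u + 1 / u) / 2, (u - 1 / u) / 2)) ` (- {0}) \<subseteq> {(x, y :: 'a). x\<^sup>2 - y\<^sup>2 = 1}"
      by auto
  qed
  then show ?thesis
    using int_card_Compl[of "{0 :: 'a}"] by (simp add: bij_betw_same_card)
qed


lemma card_square_roots_minus_one:
  assumes "(2 :: 'a :: {finite, field}) \<noteq> 0"
  shows "card {y :: 'a. y\<^sup>2 = - 1} \<in> {0, 2}"
proof (cases "\<exists>i :: 'a. i\<^sup>2 = - 1")
  case True
  then obtain i :: 'a where i: "i\<^sup>2 = - 1"
    by blast
  then have "i \<noteq> 0"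
    by auto
  then have "positive_elem (- 1 :: 'a)"
    using positive_elem_square[of i] i by simp
  then show ?thesis
    using card_square_roots[OF assms] by simp
qed auto

text \<open>Points of the hyperbola are sorted by \<open>a = x\<^sup>2\<close>. The constant 3
  collects the two points with \<open>y = 0\<close> and the difference of 1 between the order of the
  field and the number of points.\<close>

lemma card_positive_pairs:
  assumes "(2 :: 'a :: {finite, field}) \<noteq> 0"
  shows "card (UNIV :: 'a set) =
     4 * card {a :: 'a. positive_elem a \<and> positive_elem (a - 1)} + card {y :: 'a. y\<^sup>2 = - 1} + 3"
proof -
  let ?P = "{a :: 'a. positive_elem a \<and> positive_elem (a - 1)}"
  let ?F = "\<lambda>a :: 'a. {x. x\<^sup>2 = a} \<times> {y. y\<^sup>2 = a - 1}"
  \<comment> \<open>The points with a zero coordinate, where \<open>x\<^sup>2\<close> or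
    \<open>y\<^sup>2\<close> fails to be positive.\<close>
  let ?X = "{x :: 'a. x\<^sup>2 = 1} \<times> {0 :: 'a}" and ?Y = "{0 :: 'a} \<times> {y :: 'a. y\<^sup>2 = - 1}"
  have hyp: "{(x, y :: 'a). x\<^sup>2 - y\<^sup>2 = 1} = (\<Union>a \<in> ?P. ?F a) \<union> (?X \<union> ?Y)"
  proof (rule Set.set_eqI)
    fix p :: "'a \<times> 'a"
    obtain x y where p: "p = (x, y)"
      by (cases p)
    have "x\<^sup>2 - y\<^sup>2 = 1 \<longleftrightarrow> y\<^sup>2 = x\<^sup>2 - 1"
      by (auto simp: algebra_simps)
    also have "\<dots> \<longleftrightarrow> positive_elem (x\<^sup>2) \<and> positive_elem (x\<^sup>2 - 1) \<and> y\<^sup>2 = x\<^sup>2 - 1 \<or>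
        x\<^sup>2 = 1 \<and> y = 0 \<or> x = 0 \<and> y\<^sup>2 = - 1"
      using positive_elem_square[of x] positive_elem_square[of y] by (cases "x = 0"; cases "y = 0") auto
    also have "\<dots> \<longleftrightarrow> (x, y) \<in> (\<Union>a \<in> ?P. ?F a) \<union> (?X \<union> ?Y)"
      by auto
    finally show "p \<in> {(x, y). x\<^sup>2 - y\<^sup>2 = 1} \<longleftrightarrow> p \<in> (\<Union>a \<in> ?P. ?F a) \<union> (?X \<union> ?Y)"
      unfolding p by simp
  qed
  have "card (\<Union>a \<in> ?P. ?F a) = (\<Sum>a \<in> ?P. card (?F a))"
    by (intro card_UN_disjoint) auto
  also have "\<dots> = 4 * card ?P"
    using card_square_roots[OF assms] by (simp add: card_cartesian_product)
  finally have "card (\<Union>a \<in> ?P. ?F a) = 4 * card ?P" .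
  moreover have "card (?X \<union> ?Y) = 2 + card {y :: 'a. y\<^sup>2 = - 1}"
  proof -
    have "card {x :: 'a. x\<^sup>2 = 1} = 2"
      using card_square_roots[OF assms, of 1] positive_elem_square[of "1 :: 'a"] by simp
    moreover have "?X \<inter> ?Y = {}"
      by auto
    ultimately show ?thesis
      by (subst card_Un_disjoint) (simp_all add: card_cartesian_product)
  qed
  moreover have "card ((\<Union>a \<in> ?P. ?F a) \<union> (?X \<union> ?Y)) = card (\<Union>a \<in> ?P. ?F a) + card (?X \<union> ?Y)"
  proof (rule card_Un_disjoint)
    have "\<not> positive_elem (0 :: 'a)"
      by (simp add: positive_elem_def)
    then show "(\<Union>a \<in> ?P. ?F a) \<inter> (?X \<union> ?Y) = {}"
      by auto
  qed simp_all
  ultimately have "card (UNIV :: 'a set) - 1 = 4 * card ?P + card {y :: 'a. y\<^sup>2 = - 1} + 2"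
    using card_hyperbola[OF assms] hyp by simp
  \<comment> \<open>Guards against truncation in the natural number subtraction
    \<open>card UNIV - 1\<close>.\<close>
  moreover have "card (UNIV :: 'a set) > 0"
    by (simp add: card_gt_0_iff)
  ultimately show ?thesis
    by linarith
qed

theorem lemma5p4:
  fixes q :: nat
  assumes "primepow q"
    and "card (UNIV :: 'a :: finite_field set) = q"
  shows "real (card (elementary_tp_mats 2 :: 'a mat set)) =
           (if even q then real q - 2
            else if q mod 4 = 1 then (real q - 5) / 4
            else (real q - 3) / 4) \<and>
         (CHAR('a) = 2 \<longrightarrow>
           int (card (elementary_tp_mats 3 :: 'a mat set)) =
             (int q - 2) * (int q - 3) * ((int q)\<^sup>2 - 9 * int q + 21))"
proof (intro conjI impI)
  have CHAR: "CHAR('a) = 2 \<longleftrightarrow> even q"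
    using CHAR_eq_2_iff_even_card[where 'a = 'a] assms by simp
  let ?P = "{a :: 'a. positive_elem a \<and> positive_elem (a - 1)}"
  show "real (card (elementary_tp_mats 2 :: 'a mat set)) =
           (if even q then real q - 2
            else if q mod 4 = 1 then (real q - 5) / 4
            else (real q - 3) / 4)"
  proof (cases "even q")
    case True
    then have "?P = - {0, 1}"
      using CHAR by (auto simp: positive_elem_CHAR_2)
    then have "int (card ?P) = int q - 2"
      using int_card_Compl[of "{0, 1 :: 'a}"] assms by simp
    then have "real (card ?P) = real q - 2"
      by linarith
    then show ?thesis
      using True by (simp add: card_elementary_tp_mats_2)
  next
    case False
    then have "(2 :: 'a) \<noteq> 0"
      using CHAR by (simp add: two_eq_0_iff_CHAR)
    from card_positive_pairs[OF this] card_square_roots_minus_one[OF this]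
    \<comment> \<open>The constants 3 and 5 belong to zero and two square roots of
      \<open>- 1\<close>; their residues modulo 4 differ, so \<open>q mod 4\<close> identifies the
      case.\<close>
    have "q = 4 * card ?P + 3 \<or> q = 4 * card ?P + 5"
      using assms by auto
    then show ?thesis
    proof
      assume q: "q = 4 * card ?P + 3"
      then have "q mod 4 = 3"
        by presburger
      then show ?thesis
        using False q by (simp add: card_elementary_tp_mats_2)
    next
      assume q: "q = 4 * card ?P + 5"
      then have "q mod 4 = 1"
        by presburger
      then show ?thesis
        using False q by (simp add: card_elementary_tp_mats_2)
    qed
  qed
  assume CHAR_2: "CHAR('a) = 2"
  show "int (card (elementary_tp_mats 3 :: 'a mat set)) =
             (int q - 2) * (int q - 3) * ((int q)\<^sup>2 - 9 * int q + 21)"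
    using card_elementary_tp_mats_3[OF positive_elem_CHAR_2[OF CHAR_2]] card_Sigma_Compl_forbidden[where 'a = 'a] assms(2)
    by (simp only:)
qed

end
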